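(* Let $T$ be the Sierpi\'nski carpet. Then $$\dim_{tH} T=\frac{\log 2}{\log 3}+1=\frac{\log 6}{\log 3}.$$
   Context: The Sierpi\'nski carpet $T\subseteq[0,1]^2$ is the unique non-empty compact set with $T=\bigcup_{(i,j)\in\{0,1,2\}^2\setminus\{(1,1)\}}\frac13\left(T+(i,j)\right)$, with the Euclidean metric. $\dim_H$ denotes Hausdorff dimension, with the convention $\dim_H\emptyset=-1$. The topological Hausdorff dimension is defined by $\dim_{tH}\emptyset=-1$ and, for a non-empty metric space $X$, $\dim_{tH}X=\inf\{d: X \text{ has a basis } \mathcal U \text{ of open sets such that } \dim_H\partial U\le d-1 \text{ for every } U\in\mathcal U\}$ (where $d=\infty$ is allowed, with $\infty-1=\infty$). *)

theory Defs
  imports "HOL-Analysis.Analysis"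
begin

text \<open>Metric spaces are represented as subsets \<open>X\<close> of a type of class \<open>metric_space\<close>,
  with the restricted metric and the topology \<open>top_of_set X\<close>.\<close>

text \<open>The summand \<open>(diam U)\<^sup>s\<close>, with the usual conventions that a non-empty set has
  \<open>(diam U)\<^sup>0 = 1\<close> and that the empty set contributes nothing; the case distinction
  is needed because \<open>0 powr 0 = 0\<close>.\<close>

definition diam_pow :: "real \<Rightarrow> 'a::metric_space set \<Rightarrow> ennreal" where
  "diam_pow s U =
     (if U = {} then 0 else if s = 0 then 1 else ennreal (diameter U powr s))"

text \<open>\<open>diameter\<close> is real-valued and meaningless on unbounded sets, hence the explicit
  boundedness requirement on the members of a \<open>\<delta>\<close>-cover.\<close>

definition hausdorff_premeasure :: "real \<Rightarrow> real \<Rightarrow> 'a::metric_space set \<Rightarrow> ennreal" where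
  "hausdorff_premeasure s \<delta> X =
     (INF U\<in>{U :: nat \<Rightarrow> 'a set. X \<subseteq> (\<Union>i. U i) \<and>
               (\<forall>i. bounded (U i) \<and> diameter (U i) \<le> \<delta>)}. \<Sum>i. diam_pow s (U i))"

definition hausdorff_measure :: "real \<Rightarrow> 'a::metric_space set \<Rightarrow> ennreal" where
  "hausdorff_measure s X = (SUP \<delta>\<in>{0<..}. hausdorff_premeasure s \<delta> X)"

definition dim_H :: "'a::metric_space set \<Rightarrow> ereal" where
  "dim_H X = (if X = {} then -1
     else Inf {ereal s | s. 0 \<le> s \<and> hausdorff_measure s X = 0})"

text \<open>The analogue of \<^const>\<open>topological_basis\<close> for an abstract topology.\<close>

definition basis_of_topology :: "'a topology \<Rightarrow> 'a set set \<Rightarrow> bool" where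
  "basis_of_topology \<T> B \<longleftrightarrow>
     (\<forall>U\<in>B. openin \<T> U) \<and> (\<forall>V. openin \<T> V \<longrightarrow> (\<exists>B'\<subseteq>B. \<Union>B' = V))"

text \<open>The boundary of \<open>U\<close> is taken relative to the space \<open>X\<close>. Here \<open>d\<close> ranges over the
  extended reals, where \<open>\<infinity> - 1 = \<infinity>\<close>; negative \<open>d\<close> are excluded automatically,
  since \<open>dim_H\<close> is at least \<open>-1\<close> and a basis of a non-empty space is non-empty.\<close>

definition dim_tH :: "'a::metric_space set \<Rightarrow> ereal" where
  "dim_tH X = (if X = {} then -1
     else Inf {d :: ereal. \<exists>B. basis_of_topology (top_of_set X) B \<and>
                 (\<forall>U\<in>B. dim_H (top_of_set X frontier_of U) \<le> d - 1)})"

text \<open>The metric on \<^typ>\<open>real \<times> real\<close> is the Euclidean one.\<close>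

definition sierpinski_carpet :: "(real \<times> real) set" where
  "sierpinski_carpet = (THE T. T \<noteq> {} \<and> compact T \<and>
     T = (\<Union>v \<in> {0, 1, 2} \<times> {0, 1, 2} - {(1, 1)}. (\<lambda>x. (1 / 3) *\<^sub>R (x + v)) ` T))"

end

theory Submission
  imports Defs
begin

text \<open>Upper bound: every point of the carpet has small box neighbourhoods whose sides lie on lines
  \<open>x = c\<close> or \<open>y = c\<close> with \<open>c = (2 k + 1) / (2 \<cdot> 3\<^sup>n)\<close>. From the \<open>n\<close>-th ternary digit on, all
  digits of \<open>c\<close> equal \<open>1\<close>, which leaves only the digits \<open>0\<close> and \<open>2\<close> for the other
  coordinate, so such a line meets the carpet in a set of dimension at most \<open>ln 2 / ln 3\<close>.

  Lower bound: the carpet contains \<open>C \<times> [0,1]\<close> for the Cantor set \<open>C\<close>. A small open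
  neighbourhood of the origin contains \<open>(x, 0)\<close> but not \<open>(x, 1)\<close> for all \<open>x \<in> C\<close> near
  \<open>0\<close>, so its boundary projects onto a piece of \<open>C\<close>. The Cantor function, which is Hoelder
  continuous with exponent \<open>ln 2 / ln 3\<close>, maps that piece onto an interval of positive length.\<close>

section \<open>The iterated function system of the carpet and its attractor\<close>

definition carpet_digits :: "(real \<times> real) set" where
  "carpet_digits = {0, 1, 2} \<times> {0, 1, 2} - {(1, 1)}"

definition carpet_map :: "real \<times> real \<Rightarrow> real \<times> real \<Rightarrow> real \<times> real" where
  "carpet_map v x = (1 / 3) *\<^sub>R (x + v)"

definition carpet_step :: "(real \<times> real) set \<Rightarrow> (real \<times> real) set" where
  "carpet_step A = (\<Union>v\<in>carpet_digits. carpet_map v ` A)"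

lemma finite_carpet_digits [simp]: "finite carpet_digits"
  by (simp add: carpet_digits_def)

lemma dist_carpet_map: "dist (carpet_map v x) (carpet_map v y) = dist x y / 3"
  unfolding carpet_map_def dist_scaleR[symmetric] by (simp add: dist_norm flip: scaleR_diff_right)

lemma carpet_map_inverse: "carpet_map v x = y \<longleftrightarrow> x = 3 *\<^sub>R y - v"
proof -
  have "carpet_map v x = y \<longleftrightarrow> 3 *\<^sub>R carpet_map v x = 3 *\<^sub>R y"
    by simp
  also have "3 *\<^sub>R carpet_map v x = x + v"
    by (simp add: carpet_map_def)
  finally show ?thesis by (auto simp: algebra_simps)
qed

lemma carpet_step_iff: "x \<in> carpet_step A \<longleftrightarrow> (\<exists>v\<in>carpet_digits. 3 *\<^sub>R x - v \<in> A)"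
proof -
  have "x \<in> carpet_map v ` A \<longleftrightarrow> 3 *\<^sub>R x - v \<in> A" for v
    using carpet_map_inverse[of v _ x] by (metis image_iff)
  then show ?thesis
    by (simp add: carpet_step_def)
qed

lemma carpet_step_mono: "A \<subseteq> B \<Longrightarrow> carpet_step A \<subseteq> carpet_step B"
  by (auto simp: carpet_step_def)

lemma compact_carpet_step: "compact A \<Longrightarrow> compact (carpet_step A)"
  unfolding carpet_step_def carpet_map_def
  by (intro compact_UN finite_carpet_digits compact_continuous_image continuous_intros)

text \<open>Each step contracts distances by \<open>1/3\<close>, so the supremum \<open>h\<close> over \<open>A\<close> of the distances
  to \<open>K\<close> satisfies \<open>h \<le> h / 3\<close>.\<close>

lemma carpet_step_coinduct:
  assumes A: "bounded A" "A \<subseteq> carpet_step A"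
    and K: "closed K" "K \<noteq> {}" "carpet_step K \<subseteq> K"
  shows "A \<subseteq> K"
proof (cases "A = {}")
  case False
  define h where "h = (SUP x\<in>A. infdist x K)"
  obtain k where k: "k \<in> K" using K by auto
  obtain e where e: "\<And>x. x \<in> A \<Longrightarrow> dist k x \<le> e"
    using A(1) bounded_any_center[of A k] by blast
  have bdd: "bdd_above ((\<lambda>x. infdist x K) ` A)"
  proof (rule bdd_aboveI2)
    fix x assume "x \<in> A"
    with e have "dist x k \<le> e" by (metis dist_commute)
    with k show "infdist x K \<le> e" by (rule infdist_le2)
  qed
  have "infdist x K \<le> h / 3" if x: "x \<in> A" for x
  proof -
    obtain v where v: "v \<in> carpet_digits" "3 *\<^sub>R x - v \<in> A"
      using x A(2) carpet_step_iff[of x A] by blast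
    obtain z where z: "z \<in> K" "infdist (3 *\<^sub>R x - v) K = dist (3 *\<^sub>R x - v) z"
      using infdist_attains_inf[OF K(1,2)] by blast
    have "carpet_map v z \<in> K"
      using z v K(3) by (auto simp: carpet_step_def)
    then have "infdist x K \<le> dist x (carpet_map v z)"
      by (rule infdist_le)
    also have "dist x (carpet_map v z) = dist (carpet_map v (3 *\<^sub>R x - v)) (carpet_map v z)"
      using carpet_map_inverse[of v "3 *\<^sub>R x - v" x] by simp
    also have "\<dots> = infdist (3 *\<^sub>R x - v) K / 3"
      by (simp only: dist_carpet_map z)
    also have "infdist (3 *\<^sub>R x - v) K \<le> h"
      unfolding h_def by (rule cSUP_upper[OF v(2) bdd])
    finally show ?thesis by simp
  qed
  note bound = this
  then have "h \<le> h / 3"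
    by (subst (1) h_def) (rule cSUP_least[OF False])
  then have "infdist x K = 0" if "x \<in> A" for x
    using bound[OF that] infdist_nonneg[of x K] by linarith
  then show ?thesis
    using in_closed_iff_infdist_zero[OF K(1,2)] by auto
qed auto

abbreviation unit_square :: "(real \<times> real) set" where
  "unit_square \<equiv> {0..1} \<times> {0..1}"

lemma carpet_step_unit_square: "carpet_step unit_square \<subseteq> unit_square"
  by (auto simp: carpet_step_def carpet_map_def carpet_digits_def)

text \<open>The iterates of the unit square are nested non-empty compact sets, and their
  intersection is the attractor. Only its inclusion in its own image needs an argument, since the
  digit found for a point may vary with the level.\<close>

lemma carpet_attractor_exists: "\<exists>T. T \<noteq> {} \<and> compact T \<and> T = carpet_step T"
proof -
  define Q where "Q n = (carpet_step ^^ n) unit_square" for n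
  have Q_Suc: "Q (Suc n) = carpet_step (Q n)" for n
    by (simp add: Q_def)
  have comp: "compact (Q n)" for n
    by (induction n) (auto simp: Q_Suc compact_carpet_step, simp add: Q_def compact_Times)
  have ne: "Q n \<noteq> {}" for n
  proof (induction n)
    case (Suc n)
    have "(0, 0) \<in> carpet_digits" by (simp add: carpet_digits_def)
    with Suc show ?case by (auto simp: Q_Suc carpet_step_def)
  qed (simp add: Q_def)
  have dec: "Q (Suc n) \<subseteq> Q n" for n
  proof (induction n)
    case 0 show ?case using carpet_step_unit_square by (simp add: Q_def)
  qed (simp add: Q_Suc carpet_step_mono)
  then have anti: "Q n \<subseteq> Q m" if "m \<le> n" for m n
    using lift_Suc_antimono_le that by metis
  let ?T = "\<Inter>n. Q n"
  have "?T \<noteq> {}"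
    using compact_nest[of Q] comp ne anti by simp
  moreover have "compact ?T"
    by (intro compact_Inter) (auto simp: comp)
  moreover have "?T \<subseteq> carpet_step ?T"
  proof
    fix x assume "x \<in> ?T"
    then have "\<forall>n. \<exists>v\<in>carpet_digits. 3 *\<^sub>R x - v \<in> Q n"
      by (metis InterE Q_Suc carpet_step_iff rangeI)
    then obtain v where v: "\<And>n. v n \<in> carpet_digits" "\<And>n. 3 *\<^sub>R x - v n \<in> Q n"
      by metis
    have "finite (range v)"
      using v by (intro finite_subset[OF _ finite_carpet_digits]) auto
    \<comment> \<open>One of the finitely many digits recurs at infinitely many levels. As the sets
      \<open>Q n\<close> decrease, this digit works at every level.\<close>
    then obtain m where m: "infinite {n. v n = v m}"
      using pigeonhole_infinite[of UNIV v] by auto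
    have "3 *\<^sub>R x - v m \<in> Q n" for n
    proof -
      obtain l where "l > n" "v l = v m"
        using m unfolding infinite_nat_iff_unbounded by auto
      with v(2)[of l] anti[of n l] show ?thesis by auto
    qed
    then show "x \<in> carpet_step ?T"
      using v(1)[of m] unfolding carpet_step_iff by blast
  qed
  moreover have "carpet_step ?T \<subseteq> ?T"
  proof -
    have "carpet_step ?T \<subseteq> Q n" for n
      using carpet_step_mono[of ?T "Q n"] dec[of n] by (auto simp: Q_Suc)
    then show ?thesis by blast
  qed
  ultimately show ?thesis by blast
qed

text \<open>Two attractors contain each other by \<open>carpet_step_coinduct\<close>, so the
  description by \<open>THE\<close> denotes the one constructed above.\<close>

lemma sierpinski_carpet_attractor:
  "sierpinski_carpet \<noteq> {} \<and> compact sierpinski_carpet \<and>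
    sierpinski_carpet = carpet_step sierpinski_carpet"
proof -
  let ?P = "\<lambda>T. T \<noteq> {} \<and> compact T \<and> T = carpet_step T"
  have "\<exists>!T. ?P T"
  proof (rule ex_ex1I)
    fix S T assume "?P S" "?P T"
    then show "S = T"
      using carpet_step_coinduct[of S T] carpet_step_coinduct[of T S]
      by (auto simp: compact_imp_bounded compact_imp_closed)
  qed (rule carpet_attractor_exists)
  then have "?P (THE T. ?P T)"
    by (rule theI')
  moreover have "sierpinski_carpet = (THE T. ?P T)"
    unfolding sierpinski_carpet_def carpet_step_def carpet_digits_def carpet_map_def by simp
  ultimately show ?thesis by simp
qed

lemmas compact_sierpinski_carpet = sierpinski_carpet_attractor[THEN conjunct2, THEN conjunct1]
  and carpet_step_sierpinski_carpet =
    sierpinski_carpet_attractor[THEN conjunct2, THEN conjunct2, symmetric]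

lemma sierpinski_carpet_subset: "sierpinski_carpet \<subseteq> unit_square"
  by (rule carpet_step_coinduct)
    (simp_all add: compact_sierpinski_carpet compact_imp_bounded carpet_step_sierpinski_carpet
      closed_Times carpet_step_unit_square)

text \<open>Coinduction principle for membership: every point of \<open>A\<close> has some digit
  whose removal leads back into \<open>A\<close>.\<close>

lemma subset_sierpinski_carpet:
  "bounded A \<Longrightarrow> A \<subseteq> carpet_step A \<Longrightarrow> A \<subseteq> sierpinski_carpet"
  by (rule carpet_step_coinduct)
    (simp_all add: sierpinski_carpet_attractor[THEN conjunct1] compact_sierpinski_carpet
      compact_imp_closed carpet_step_sierpinski_carpet)

section \<open>Ternary points with digits 0 and 2, and the Cantor function\<close>

text \<open>The inverse of the Cantor function: binary digits \<open>d\<close> become ternary digits \<open>2 d\<close>.\<close>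

definition cantor_point :: "real \<Rightarrow> real" where
  "cantor_point t = (\<Sum>n. 2 * of_int (\<lfloor>2 ^ Suc n * t\<rfloor> mod 2) / 3 ^ Suc n)"

lemma cantor_digit_cases: "(i::int) mod 2 = 0 \<or> i mod 2 = 1"
  by presburger

lemma cantor_point_sum_bound:
  fixes t :: real
  shows "norm (2 * of_int (\<lfloor>2 ^ Suc n * t\<rfloor> mod 2) / 3 ^ Suc n :: real) \<le> 2 / 3 * (1 / 3) ^ n"
  using cantor_digit_cases[of "\<lfloor>2 ^ Suc n * t\<rfloor>"] by (auto simp: field_simps)

lemma cantor_point_summable:
  fixes t :: real
  shows "summable (\<lambda>n. 2 * of_int (\<lfloor>2 ^ Suc n * t\<rfloor> mod 2) / 3 ^ Suc n :: real)"
  by (rule summable_comparison_test'[OF _ cantor_point_sum_bound])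
     (intro summable_mult summable_geometric, simp)

lemma cantor_point_bounds: "cantor_point t \<in> {0..1}"
proof -
  have "cantor_point t \<le> (\<Sum>n. 2 / 3 * (1 / 3) ^ n)"
    unfolding cantor_point_def
    by (intro suminf_le cantor_point_summable summable_mult summable_geometric)
      (use cantor_point_sum_bound in \<open>auto intro: order_trans[OF norm_ge_zero] order_trans[OF abs_ge_self]\<close>)
  also have "\<dots> = 2 / 3 * (\<Sum>n. (1 / 3 :: real) ^ n)"
    by (intro suminf_mult summable_geometric) simp
  also have "\<dots> = 1"
    by (subst suminf_geometric) auto
  finally have "cantor_point t \<le> 1" .
  moreover have "0 \<le> cantor_point t"
    unfolding cantor_point_def by (intro suminf_nonneg cantor_point_summable) auto
  ultimately show ?thesis by simp
qed

text \<open>Self-similarity: removing the first binary digit of \<open>t\<close> shifts the ternary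
  expansion by one place.\<close>

lemma cantor_point_rec:
  fixes t :: real and d :: int
  assumes "d = 0 \<or> d = 1" "\<lfloor>2 * t\<rfloor> = d"
  shows "cantor_point t = (cantor_point (2 * t - of_int d) + 2 * of_int d) / 3"
proof -
  define a where "a t n = (2 * of_int (\<lfloor>2 ^ Suc n * t\<rfloor> mod 2) / 3 ^ Suc n :: real)" for t :: real and n
  have eq: "a t (Suc n) = a (2 * t - d) n / 3" for n
  proof -
    \<comment> \<open>Removing \<open>d\<close> shifts the scaled argument by an even integer, so
      the parity of its floor, which is the digit, is unchanged.\<close>
    have "2 ^ Suc (Suc n) * t = 2 ^ Suc n * (2 * t - d) + of_int (2 * (2 ^ n * d))"
      by (simp add: algebra_simps)
    then have "\<lfloor>2 ^ Suc (Suc n) * t\<rfloor> = \<lfloor>2 ^ Suc n * (2 * t - d)\<rfloor> + 2 * (2 ^ n * d)"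
      by (metis floor_add_int)
    then have "\<lfloor>2 ^ Suc (Suc n) * t\<rfloor> mod 2 = \<lfloor>2 ^ Suc n * (2 * t - d)\<rfloor> mod 2"
      by simp
    then show ?thesis unfolding a_def by simp
  qed
  have sm: "summable (a t)" for t
    unfolding a_def by (rule cantor_point_summable)
  have cp: "cantor_point t = suminf (a t)" for t
    by (simp add: cantor_point_def a_def[abs_def])
  have "cantor_point t = a t 0 + (\<Sum>n. a t (Suc n))"
    using suminf_split_head[OF sm[of t]] by (simp add: cp)
  also have "(\<Sum>n. a t (Suc n)) = (\<Sum>n. a (2 * t - d) n) / 3"
    unfolding eq by (rule suminf_divide[OF sm])
  also have "(\<Sum>n. a (2 * t - d) n) = cantor_point (2 * t - d)"
    by (simp add: cp)
  also have "a t 0 = 2 * d / 3"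
    using assms by (auto simp: a_def)
  finally show ?thesis by simp
qed

lemma cantor_point_step:
  fixes t :: real
  assumes "t \<in> {0..<1}"
  obtains d :: int where "d = 0 \<or> d = 1" "2 * t - d \<in> {0..<1}"
    "cantor_point t = (cantor_point (2 * t - of_int d) + 2 * of_int d) / 3"
proof -
  have "\<lfloor>2 * t\<rfloor> = 0 \<or> \<lfloor>2 * t\<rfloor> = 1"
    using assms by (auto simp: floor_eq_iff)
  moreover have "2 * t - \<lfloor>2 * t\<rfloor> \<in> {0..<1}"
    by (simp, linarith)
  ultimately show thesis
    using that[of "\<lfloor>2 * t\<rfloor>"] cantor_point_rec by blast
qed

abbreviation cantor_dim :: real where
  "cantor_dim \<equiv> ln 2 / ln 3"

lemma powr_cantor_dim_3: "3 powr cantor_dim = 2"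
  by (simp add: powr_def)

text \<open>Hoelder continuity of the Cantor function, stated through its inverse. The exponent fits
  because \<open>3 powr cantor_dim = 2\<close>: removing a common first digit doubles both
  sides.\<close>

lemma cantor_point_holder:
  assumes "t \<in> {0..<1}" "u \<in> {0..<1}"
  shows "\<bar>t - u\<bar> \<le> 2 * \<bar>cantor_point t - cantor_point u\<bar> powr cantor_dim"
proof (cases "t = u")
  case False
  \<comment> \<open>The auxiliary \<open>n\<close> bounds the number of common leading digits. Each
    removal doubles the distance, and for \<open>n = 0\<close> the premise contradicts that the
    distance is below 1.\<close>
  have "\<bar>t - u\<bar> \<le> 2 * \<bar>cantor_point t - cantor_point u\<bar> powr cantor_dim"
    if "1 / 2 ^ n \<le> \<bar>t - u\<bar>" for n
    using that assms
  proof (induction n arbitrary: t u)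
    case (Suc n)
    obtain d where d: "d = 0 \<or> d = 1" "2 * t - of_int d \<in> {0..<1}"
      "cantor_point t = (cantor_point (2 * t - of_int d) + 2 * of_int d) / 3"
      using cantor_point_step[OF Suc.prems(2)] .
    obtain e where e: "e = 0 \<or> e = 1" "2 * u - of_int e \<in> {0..<1}"
      "cantor_point u = (cantor_point (2 * u - of_int e) + 2 * of_int e) / 3"
      using cantor_point_step[OF Suc.prems(3)] .
    let ?t = "2 * t - of_int d" and ?u = "2 * u - of_int e"
    show ?case
    proof (cases "d = e")
      case True
      have eq: "\<bar>?t - ?u\<bar> = 2 * \<bar>t - u\<bar>"
        using True by (simp add: abs_if)
      have "1 / 2 ^ n \<le> 2 * \<bar>t - u\<bar>"
        using Suc.prems(1) by (simp add: field_simps)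
      then have "1 / 2 ^ n \<le> \<bar>?t - ?u\<bar>"
        by (simp only: eq)
      then have "\<bar>?t - ?u\<bar> \<le> 2 * \<bar>cantor_point ?t - cantor_point ?u\<bar> powr cantor_dim"
        using Suc.IH d(2) e(2) by blast
      also have "cantor_point ?t - cantor_point ?u = 3 * (cantor_point t - cantor_point u)"
        using d(3) e(3) True by simp
      also have "\<bar>3 * (cantor_point t - cantor_point u)\<bar> powr cantor_dim =
          2 * \<bar>cantor_point t - cantor_point u\<bar> powr cantor_dim"
        by (simp only: abs_mult abs_numeral powr_mult powr_cantor_dim_3)
      also note eq
      finally show ?thesis by simp
    next
      case False
      \<comment> \<open>Different first digits put the two values into [0, 1/3] and [2/3, 1]. Since
        (1/3) to the power \<open>cantor_dim\<close> is 1/2, the right-hand side is then at least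
        1.\<close>
      have "1 / 3 \<le> \<bar>cantor_point t - cantor_point u\<bar>"
        using False d(1,3) e(1,3) cantor_point_bounds[of ?t] cantor_point_bounds[of ?u]
        by auto
      then have "(1 / 3) powr cantor_dim \<le> \<bar>cantor_point t - cantor_point u\<bar> powr cantor_dim"
        by (intro powr_mono2) auto
      moreover have "(1 / 3) powr cantor_dim = 1 / 2"
        by (simp only: powr_divide powr_cantor_dim_3 powr_one_eq_one)
      moreover have "\<bar>t - u\<bar> \<le> 1"
        using Suc.prems by auto
      ultimately show ?thesis by linarith
    qed
  qed auto
  moreover obtain n where "(1 / 2) ^ n < \<bar>t - u\<bar>"
    using real_arch_pow_inv[of "\<bar>t - u\<bar>" "1 / 2"] False by auto
  ultimately show ?thesis by (auto simp: power_one_over dest: less_imp_le)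
qed simp

text \<open>The first \<open>n\<close> binary digits of \<open>t\<close> vanish, hence so do the
  first \<open>n\<close> ternary digits of its image.\<close>

lemma cantor_point_small:
  "t \<in> {0..<1 / 2 ^ n} \<Longrightarrow> cantor_point t \<le> 1 / 3 ^ n"
proof (induction n arbitrary: t)
  case (Suc n)
  have "t * 2 * 1 \<le> t * 2 * 2 ^ n"
    using Suc.prems by (intro mult_left_mono) auto
  then have "\<lfloor>2 * t\<rfloor> = 0"
    using Suc.prems by (auto simp: floor_eq_iff field_simps)
  then have "cantor_point t = cantor_point (2 * t) / 3"
    using cantor_point_rec[of 0 t] by simp
  moreover have "cantor_point (2 * t) \<le> 1 / 3 ^ n"
    using Suc.prems by (intro Suc.IH) (auto simp: field_simps)
  ultimately show ?case by simp
qed (use cantor_point_bounds in auto)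

text \<open>Coinduction applies to the whole product of the Cantor points with the unit
  interval.\<close>

lemma cantor_segment_in_carpet:
  assumes "t \<in> {0..<1}" "y \<in> {0..1}"
  shows "(cantor_point t, y) \<in> sierpinski_carpet"
proof -
  let ?A = "(cantor_point ` {0..<1}) \<times> {0..1::real}"
  have "?A \<subseteq> unit_square"
    using cantor_point_bounds by auto
  then have "bounded ?A"
    using bounded_subset[OF compact_imp_bounded] by (metis compact_Icc compact_Times)
  moreover have "?A \<subseteq> carpet_step ?A"
  proof clarify
    fix t y :: real
    assume t: "t \<in> {0..<1}" and y: "y \<in> {0..1}"
    obtain d where d: "d = 0 \<or> d = 1" "2 * t - of_int d \<in> {0..<1}"
      "cantor_point t = (cantor_point (2 * t - of_int d) + 2 * of_int d) / 3"
      using cantor_point_step[OF t] .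
    obtain j :: real where j: "j \<in> {0, 1, 2}" "3 * y - j \<in> {0..1}"
    proof (cases "y \<le> 1 / 3")
      case True then show ?thesis using that[of 0] y by auto
    next
      case False then show ?thesis
        using that[of 1] that[of 2] y by (cases "y \<le> 2 / 3") auto
    qed
    \<comment> \<open>The first component is 0 or 2, so the excluded digit (1, 1) never arises,
      whatever \<open>j\<close> is.\<close>
    have "(2 * of_int d, j) \<in> carpet_digits"
      using d(1) j(1) by (auto simp: carpet_digits_def)
    moreover have "3 *\<^sub>R (cantor_point t, y) - (2 * of_int d, j) =
        (cantor_point (2 * t - of_int d), 3 * y - j)"
      using d(3) by simp
    ultimately show "(cantor_point t, y) \<in> carpet_step ?A"
      unfolding carpet_step_iff using d(2) j(2)
      by (intro bexI[of _ "(2 * of_int d, j)"]) (simp_all only: mem_Times_iff fst_conv snd_conv image_eqI)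
  qed
  ultimately have "?A \<subseteq> sierpinski_carpet"
    by (rule subset_sierpinski_carpet)
  then show ?thesis using assms by auto
qed

section \<open>Boxes and the density of triadic midpoints\<close>

lemma box_frontier_subset:
  "top_of_set X frontier_of (X \<inter> box a b) \<subseteq> X \<inter> (cbox a b - box a b)"
proof -
  have "top_of_set X closure_of (X \<inter> box a b) \<subseteq> cbox a b"
  proof -
    have "closure (X \<inter> (X \<inter> box a b)) \<subseteq> cbox a b"
      using box_subset_cbox by (intro closure_minimal closed_cbox) blast
    then show ?thesis
      by (auto simp: closure_of_subtopology)
  qed
  moreover have "top_of_set X interior_of (X \<inter> box a b) = X \<inter> box a b"
    by (simp add: interior_of_eq openin_open_Int open_box)
  moreover have "top_of_set X frontier_of (X \<inter> box a b) \<subseteq> X"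
    by (rule frontier_of_subset_subtopology)
  ultimately show ?thesis
    by (auto simp: frontier_of_def)
qed

text \<open>The midpoints of the intervals from \<open>k / 3 ^ n\<close> to
  \<open>(k + 1) / 3 ^ n\<close>.\<close>

definition triadic_midpoints :: "real set" where
  "triadic_midpoints = {(2 * of_int k + 1) / (2 * 3 ^ n) | k n. True}"

lemma triadic_midpoint_between:
  assumes "p < q"
  obtains a where "a \<in> triadic_midpoints" "p < a" "a < q"
proof -
  obtain n where n: "(1 / 3) ^ n < q - p"
    using real_arch_pow_inv[of "q - p" "1 / 3"] assms by auto
  \<comment> \<open>This \<open>k\<close> gives the first midpoint of level \<open>n\<close> beyond
    \<open>p\<close>. It lies at most \<open>1 / 3 ^ n\<close> beyond \<open>p\<close>, hence before
    \<open>q\<close>.\<close>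
  define k where "k = \<lfloor>p * 3 ^ n - 1 / 2\<rfloor> + 1"
  define a where "a = (2 * of_int k + 1) / (2 * 3 ^ n :: real)"
  have k: "of_int k > p * 3 ^ n - 1 / 2" "of_int k \<le> p * 3 ^ n + 1 / 2"
    unfolding k_def by linarith+
  have a: "a * 3 ^ n = of_int k + 1 / 2"
    by (simp add: a_def field_simps)
  have "p * 3 ^ n + 1 < q * 3 ^ n"
    using n by (simp add: field_simps)
  with a k have "p * 3 ^ n < a * 3 ^ n" "a * 3 ^ n < q * 3 ^ n"
    by linarith+
  then have "p < a" "a < q"
    by (simp_all add: mult_less_cancel_right_disj)
  moreover have "a \<in> triadic_midpoints"
    unfolding triadic_midpoints_def a_def by blast
  ultimately show thesis using that by blast
qed

section \<open>Sets with coverings that grow like those of the Cantor set\<close>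

text \<open>A uniform form of upper box dimension at most \<open>cantor_dim\<close>, as 2 is 3 to
  that power. The constant \<open>C\<close> makes the property stable under finite unions, and the
  radius 2 at level 0 suits the unit square.\<close>

definition cantor_coverable :: "(real \<times> real) set \<Rightarrow> bool" where
  "cantor_coverable L \<longleftrightarrow> (\<exists>C::nat. \<forall>m. \<exists>A. finite A \<and> card A \<le> C * 2 ^ m \<and>
     L \<subseteq> (\<Union>p\<in>A. cball p (2 / 3 ^ m)))"

lemma cantor_coverable_subset: "cantor_coverable L \<Longrightarrow> K \<subseteq> L \<Longrightarrow> cantor_coverable K"
  unfolding cantor_coverable_def by (meson order_trans)

lemma cantor_coverable_empty: "cantor_coverable {}"
  unfolding cantor_coverable_def by (metis empty_subsetI finite.emptyI card.empty zero_le)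

lemma cantor_coverable_Un:
  assumes "cantor_coverable K" "cantor_coverable L"
  shows "cantor_coverable (K \<union> L)"
proof -
  obtain C A where A: "\<And>m::nat. finite (A m) \<and> card (A m) \<le> C * 2 ^ m \<and>
     K \<subseteq> (\<Union>p\<in>A m. cball p (2 / 3 ^ m))"
    using assms(1) unfolding cantor_coverable_def by metis
  obtain D B where B: "\<And>m::nat. finite (B m) \<and> card (B m) \<le> D * 2 ^ m \<and>
     L \<subseteq> (\<Union>p\<in>B m. cball p (2 / 3 ^ m))"
    using assms(2) unfolding cantor_coverable_def by metis
  show ?thesis
    unfolding cantor_coverable_def
  proof (intro exI allI)
    fix m
    have "card (A m \<union> B m) \<le> (C + D) * 2 ^ m"
      using A[of m] B[of m] card_Un_le[of "A m" "B m"] by (simp add: distrib_right)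
    then show "finite (A m \<union> B m) \<and> card (A m \<union> B m) \<le> (C + D) * 2 ^ m \<and>
        K \<union> L \<subseteq> (\<Union>p\<in>A m \<union> B m. cball p (2 / 3 ^ m))"
      using A[of m] B[of m] by (auto simp only: UN_Un finite_Un)
  qed
qed

lemma cantor_coverable_UN:
  "finite I \<Longrightarrow> (\<And>i. i \<in> I \<Longrightarrow> cantor_coverable (L i)) \<Longrightarrow> cantor_coverable (\<Union>i\<in>I. L i)"
  by (induction I rule: finite_induct) (auto simp: cantor_coverable_empty cantor_coverable_Un)

lemma carpet_map_cover:
  assumes "L \<subseteq> (\<Union>p\<in>A. cball p r)"
  shows "carpet_map v ` L \<subseteq> (\<Union>p\<in>carpet_map v ` A. cball p (r / 3))"
proof -
  have "carpet_map v x \<in> cball (carpet_map v p) (r / 3)" if "x \<in> cball p r" for x p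
    using that by (simp add: dist_carpet_map)
  then show ?thesis using assms by blast
qed

lemma cantor_coverable_carpet_map:
  assumes "cantor_coverable L"
  shows "cantor_coverable (carpet_map v ` L)"
proof -
  obtain C A where A: "\<And>m::nat. finite (A m) \<and> card (A m) \<le> C * 2 ^ m \<and>
     L \<subseteq> (\<Union>p\<in>A m. cball p (2 / 3 ^ m))"
    using assms(1) unfolding cantor_coverable_def by metis
  have "finite (carpet_map v ` A m) \<and> card (carpet_map v ` A m) \<le> C * 2 ^ m \<and>
     carpet_map v ` L \<subseteq> (\<Union>p\<in>carpet_map v ` A m. cball p (2 / 3 ^ m))" for m
  proof -
    \<comment> \<open>The images of the balls are three times smaller than required. Enlarging them
      keeps both the level and the constant.\<close>
    have "cball p (2 / 3 ^ m / 3) \<subseteq> cball p (2 / 3 ^ m)" for p :: "real \<times> real"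
      by (rule subset_cball) (simp add: field_simps)
    then show ?thesis
      using A[of m] card_image_le[of "A m" "carpet_map v"] carpet_map_cover[of L "2 / 3 ^ m" "A m" v]
      by (meson UN_mono finite_imageI order_trans subset_refl)
  qed
  then show ?thesis unfolding cantor_coverable_def by blast
qed

section \<open>Axis-parallel sections of the carpet\<close>

definition carpet_line :: "(real \<times> real \<Rightarrow> real) \<Rightarrow> real \<Rightarrow> (real \<times> real) set" where
  "carpet_line c a = {x \<in> sierpinski_carpet. c x = a}"

definition middle_digits :: "(real \<times> real \<Rightarrow> real) \<Rightarrow> (real \<times> real) set" where
  "middle_digits c = {v \<in> carpet_digits. c v = 1}"

context
  fixes c :: "real \<times> real \<Rightarrow> real"
  assumes coordinate: "c = fst \<or> c = snd"
begin

lemma coordinate_map: "c (3 *\<^sub>R x - v) = 3 * c x - c v"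
  using coordinate by auto

text \<open>Magnifying the piece with digit \<open>v\<close> by 3 turns the section at
  \<open>a\<close> into part of the section at \<open>3 * a - c v\<close>.\<close>

lemma carpet_line_subset:
  "carpet_line c a \<subseteq> (\<Union>v\<in>carpet_digits. carpet_map v ` carpet_line c (3 * a - c v))"
proof
  fix x assume x: "x \<in> carpet_line c a"
  then obtain v where "v \<in> carpet_digits" "3 *\<^sub>R x - v \<in> sierpinski_carpet"
    using carpet_step_iff[of x sierpinski_carpet] carpet_step_sierpinski_carpet
    by (auto simp: carpet_line_def)
  moreover have "x = carpet_map v (3 *\<^sub>R x - v)"
    using carpet_map_inverse[of v "3 *\<^sub>R x - v" x] by simp
  moreover have "c (3 *\<^sub>R x - v) = 3 * a - c v"
    using x by (simp add: coordinate_map carpet_line_def)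
  ultimately show "x \<in> (\<Union>v\<in>carpet_digits. carpet_map v ` carpet_line c (3 * a - c v))"
    by (auto simp: carpet_line_def)
qed

lemma carpet_line_outside: "a \<notin> {0..1} \<Longrightarrow> carpet_line c a = {}"
proof -
  have "c x \<in> {0..1}" if "x \<in> sierpinski_carpet" for x
    using subsetD[OF sierpinski_carpet_subset that] coordinate by auto
  then show "a \<notin> {0..1} \<Longrightarrow> carpet_line c a = {}"
    by (auto simp: carpet_line_def)
qed

lemma card_middle_digits: "card (middle_digits c) = 2"
  using coordinate
proof
  assume "c = fst"
  moreover have "middle_digits fst = {(1, 0), (1, 2)}"
    by (auto simp: middle_digits_def carpet_digits_def)
  ultimately show ?thesis by simp
next
  assume "c = snd"
  moreover have "middle_digits snd = {(0, 1), (2, 1)}"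
    by (auto simp: middle_digits_def carpet_digits_def)
  ultimately show ?thesis by simp
qed

text \<open>The digit of \<open>1 / 2\<close> is always the middle one, for which the other coordinate has only
  two choices.\<close>

lemma carpet_line_half:
  "carpet_line c (1 / 2) \<subseteq> (\<Union>v\<in>middle_digits c. carpet_map v ` carpet_line c (1 / 2))"
proof -
  \<comment> \<open>The digits 0 and 2 send 1/2 to 3/2 and -1/2, outside the unit interval.\<close>
  have "carpet_line c (3 * (1 / 2) - c v) = {}" if "v \<in> carpet_digits - middle_digits c" for v
    using that coordinate
    by (intro carpet_line_outside) (auto simp: middle_digits_def carpet_digits_def)
  then show ?thesis
    using carpet_line_subset[of "1 / 2"] by (fastforce simp: middle_digits_def)
qed

text \<open>By \<open>carpet_line_half\<close> the section is covered by two copies of itself of a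
  third of the size, so each level doubles the number of balls and divides their radius by
  3.\<close>

lemma cantor_coverable_half: "cantor_coverable (carpet_line c (1 / 2))"
proof -
  have "\<exists>A. finite A \<and> card A \<le> 1 * 2 ^ m \<and>
      carpet_line c (1 / 2) \<subseteq> (\<Union>p\<in>A. cball p (2 / 3 ^ m))" for m
  proof (induction m)
    case 0
    have "x \<in> cball (0, 0) 2" if "x \<in> unit_square" for x
      using that sqrt_sum_squares_le_sum_abs[of "fst x" "snd x"]
      by (cases x) (auto simp: dist_Pair_Pair)
    then have "carpet_line c (1 / 2) \<subseteq> cball (0, 0) 2"
      using sierpinski_carpet_subset by (auto simp: carpet_line_def)
    then show ?case by (intro exI[of _ "{(0, 0)}"]) simp
  next
    case (Suc m)
    then obtain A where A: "finite A" "card A \<le> 2 ^ m"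
      "carpet_line c (1 / 2) \<subseteq> (\<Union>p\<in>A. cball p (2 / 3 ^ m))" by auto
    let ?B = "\<Union>v\<in>middle_digits c. carpet_map v ` A"
    have fin: "finite (middle_digits c)" by (simp add: middle_digits_def)
    have "card ?B \<le> (\<Sum>v\<in>middle_digits c. card (carpet_map v ` A))"
      by (rule card_UN_le[OF fin])
    also have "\<dots> \<le> (\<Sum>v\<in>middle_digits c. 2 ^ m)"
      using A(1,2) card_image_le order_trans by (intro sum_mono) blast
    also have "\<dots> = 2 ^ Suc m" by (simp add: card_middle_digits)
    finally have "card ?B \<le> 2 ^ Suc m" .
    moreover have "carpet_line c (1 / 2) \<subseteq> (\<Union>p\<in>?B. cball p (2 / 3 ^ Suc m))"
    proof -
      have "carpet_line c (1 / 2) \<subseteq>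
          (\<Union>v\<in>middle_digits c. \<Union>p\<in>carpet_map v ` A. cball p (2 / 3 ^ m / 3))"
        using carpet_line_half UN_mono[OF subset_refl carpet_map_cover[OF A(3)]] by (rule order_trans)
      then show ?thesis
        by (simp only: UN_UN_flatten power_Suc2 divide_divide_eq_left)
    qed
    ultimately show ?case using fin A(1) by (intro exI[of _ ?B]) simp
  qed
  then show ?thesis unfolding cantor_coverable_def by blast
qed

text \<open>Magnification by 3 lowers \<open>n\<close> by one and subtracts an integer from the
  coordinate, so the induction runs over all \<open>k\<close>. At \<open>n = 0\<close> only the
  coordinate 1/2 meets the unit interval.\<close>

lemma cantor_coverable_line:
  assumes "a \<in> triadic_midpoints"
  shows "cantor_coverable (carpet_line c a)"
proof -
  have "cantor_coverable (carpet_line c ((2 * of_int k + 1) / (2 * 3 ^ n)))" for k n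
  proof (induction n arbitrary: k)
    case 0
    show ?case
    proof (cases "k = 0")
      case True then show ?thesis using cantor_coverable_half by simp
    next
      case False
      then have "k \<le> -1 \<or> k \<ge> 1" by linarith
      then have "carpet_line c ((2 * of_int k + 1) / (2 * 3 ^ 0)) = {}"
        by (intro carpet_line_outside) auto
      then show ?thesis using cantor_coverable_empty by simp
    qed
  next
    case (Suc n)
    let ?a = "(2 * of_int k + 1) / (2 * 3 ^ Suc n) :: real"
    have "cantor_coverable (carpet_line c (3 * ?a - c v))" if v: "v \<in> carpet_digits" for v
    proof -
      obtain i :: int where i: "c v = of_int i"
      proof -
        have "c v \<in> \<int>" using v coordinate by (auto simp: carpet_digits_def)
        then show thesis using that by (auto elim: Ints_cases)
      qed
      have "3 * ?a - c v = (2 * of_int (k - i * 3 ^ n) + 1) / (2 * 3 ^ n)"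
        by (simp add: i field_simps)
      then show ?thesis by (simp only: Suc.IH)
    qed
    then have "cantor_coverable (\<Union>v\<in>carpet_digits. carpet_map v ` carpet_line c (3 * ?a - c v))"
      by (intro cantor_coverable_UN cantor_coverable_carpet_map) auto
    then show ?case
      by (rule cantor_coverable_subset[OF _ carpet_line_subset])
  qed
  then show ?thesis using assms by (auto simp: triadic_midpoints_def)
qed

end

section \<open>Lower bound for the dimension of frontiers\<close>

lemma cantor_dim_pos: "0 < cantor_dim"
  by simp

lemma dyadic_interval_subset: "{0..<1 / 2 ^ k} \<subseteq> {0..<1::real}"
  by (rule ivl_subset[THEN iffD2]) simp

text \<open>Mass distribution by pullback: a cover of \<open>D\<close> induces, through
  \<open>cantor_point\<close>, a cover of an interval of length \<open>1 / 2 ^ k\<close>, and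
  \<open>cantor_point_holder\<close> bounds the length of each part by 4 times its summand.\<close>

lemma hausdorff_measure_pos:
  fixes D :: "(real \<times> real) set"
  assumes proj: "\<And>t. t \<in> {0..<1 / 2 ^ k} \<Longrightarrow> \<exists>y. (cantor_point t, y) \<in> D"
    and r: "0 \<le> r" "r \<le> cantor_dim"
  shows "hausdorff_measure r D \<noteq> 0"
proof -
  \<comment> \<open>Scale 1 is enough, since the measure is a supremum over scales. It keeps \<rho>
    at most 1, so lowering the exponent from \<open>cantor_dim\<close> to \<open>r\<close> only
    increases the power.\<close>
  have "ennreal (1 / (4 * 2 ^ k)) \<le> (\<Sum>i. diam_pow r (U i))"
    if U: "D \<subseteq> (\<Union>i. U i)" "\<forall>i. bounded (U i) \<and> diameter (U i) \<le> 1" for U :: "nat \<Rightarrow> _"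
  proof -
    define W where "W i = {t \<in> {0..<1 / 2 ^ k}. \<exists>y. (cantor_point t, y) \<in> U i}" for i
    \<comment> \<open>The pullback \<open>W i\<close> of an arbitrary set may fail to be Borel, so
      it is enclosed in an interval.\<close>
    have "\<exists>S. W i \<subseteq> S \<and> S \<in> sets lborel \<and> emeasure lborel S \<le> 4 * diam_pow r (U i)" for i
    proof (cases "W i = {}")
      case True
      then show ?thesis by (intro exI[of _ "{}"]) simp
    next
      case False
      then obtain t y where t: "t \<in> W i" "(cantor_point t, y) \<in> U i"
        unfolding W_def by blast
      define l where "l = (if r = 0 then 1 else diameter (U i) powr r)"
      have "U i \<noteq> {}" using t(2) by blast
      then have dp: "diam_pow r (U i) = ennreal l"
        by (simp add: diam_pow_def l_def)
      have l: "0 \<le> l" by (simp add: l_def)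
      have unit: "u \<in> {0..<1}" if "u \<in> W i" for u
        using that dyadic_interval_subset unfolding W_def by blast
      have "\<bar>t - u\<bar> \<le> 2 * l" if u: "u \<in> W i" for u
      proof -
        obtain z where z: "(cantor_point u, z) \<in> U i"
          using u unfolding W_def by blast
        define \<rho> where "\<rho> = \<bar>cantor_point t - cantor_point u\<bar>"
        have "\<rho> \<le> dist (cantor_point t, y) (cantor_point u, z)"
          using dist_fst_le[of "(cantor_point t, y)" "(cantor_point u, z)"]
          by (simp add: dist_real_def \<rho>_def)
        also have "\<dots> \<le> diameter (U i)"
          using U(2) t(2) z by (intro diameter_bounded_bound) auto
        finally have \<rho>: "\<rho> \<le> diameter (U i)" .
        have \<rho>01: "0 \<le> \<rho>" "\<rho> \<le> 1"
          using \<rho> U(2) order_trans by (auto simp: \<rho>_def)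
        have "\<rho> powr cantor_dim \<le> l"
        proof (cases "r = 0")
          case True
          then show ?thesis
            using \<rho>01 powr_le1[of cantor_dim \<rho>] cantor_dim_pos by (simp add: l_def)
        next
          case False
          have "\<rho> powr cantor_dim \<le> \<rho> powr r"
            using r \<rho>01 by (intro powr_mono')
          also have "\<dots> \<le> diameter (U i) powr r"
            using r \<rho> \<rho>01 by (intro powr_mono2)
          finally show ?thesis using False by (simp add: l_def)
        qed
        then show ?thesis
          using cantor_point_holder[OF unit[OF t(1)] unit[OF u]] unfolding \<rho>_def by linarith
      qed
      then have "W i \<subseteq> {t - 2 * l..t + 2 * l}"
        by (fastforce simp: abs_le_iff)
      moreover have "emeasure lborel {t - 2 * l..t + 2 * l} = 4 * diam_pow r (U i)"
      proof -
        have "emeasure lborel {t - 2 * l..t + 2 * l} = ennreal (4 * l)"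
          using l by simp
        then show ?thesis
          using l by (simp add: dp ennreal_mult)
      qed
      ultimately show ?thesis
        by (intro exI[of _ "{t - 2 * l..t + 2 * l}"]) simp
    qed
    then obtain S where S: "\<And>i. W i \<subseteq> S i" "\<And>i. S i \<in> sets lborel"
      "\<And>i. emeasure lborel (S i) \<le> 4 * diam_pow r (U i)"
      by metis
    have "{0..<1 / 2 ^ k} \<subseteq> (\<Union>i. W i)"
      using proj U(1) by (fastforce simp: W_def)
    then have "{0..<1 / 2 ^ k} \<subseteq> (\<Union>i. S i)"
      using S(1) by blast
    have "4 * ennreal (1 / (4 * 2 ^ k)) = ennreal (4 * (1 / (4 * 2 ^ k)))"
      by (subst ennreal_mult) auto
    also have "\<dots> = emeasure lborel {0..<1 / 2 ^ k :: real}"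
      by simp
    also have "\<dots> \<le> emeasure lborel (\<Union>i. S i)"
      by (intro emeasure_mono) (use S(2) \<open>{0..<1 / 2 ^ k} \<subseteq> (\<Union>i. S i)\<close> in auto)
    also have "\<dots> \<le> (\<Sum>i. emeasure lborel (S i))"
      using S(2) by (intro emeasure_subadditive_countably) blast
    also have "\<dots> \<le> (\<Sum>i. 4 * diam_pow r (U i))"
      by (intro suminf_le summableI S(3))
    also have "\<dots> = 4 * (\<Sum>i. diam_pow r (U i))"
      by simp
    finally show ?thesis
      by (subst (asm) ennreal_mult_le_mult_iff) auto
  qed
  then have "ennreal (1 / (4 * 2 ^ k)) \<le> hausdorff_premeasure r 1 D"
    unfolding hausdorff_premeasure_def by (intro INF_greatest) blast
  also have "\<dots> \<le> hausdorff_measure r D"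
    unfolding hausdorff_measure_def by (intro SUP_upper) simp
  finally show ?thesis
    by (auto simp: ennreal_eq_0_iff power_le_zero_eq)
qed

lemma dim_H_ge_cantor_dim:
  fixes D :: "(real \<times> real) set"
  assumes proj: "\<And>t. t \<in> {0..<1 / 2 ^ k} \<Longrightarrow> \<exists>y. (cantor_point t, y) \<in> D"
  shows "ereal cantor_dim \<le> dim_H D"
proof -
  have "D \<noteq> {}" using proj[of 0] by auto
  moreover have "cantor_dim \<le> s" if "0 \<le> s" "hausdorff_measure s D = 0" for s
    using hausdorff_measure_pos[OF proj that(1)] that(2) by (meson linear)
  ultimately show ?thesis
    unfolding dim_H_def by (auto intro!: Inf_greatest)
qed

lemma cantor_point_0: "cantor_point 0 = 0"
  by (simp add: cantor_point_def)

text \<open>Over every Cantor point near \<open>0\<close> the carpet contains a vertical segment, which starts in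
  \<open>U\<close>, leaves \<open>U\<close>, and hence meets its frontier.\<close>

lemma dim_H_frontier_ge:
  assumes U: "openin (top_of_set sierpinski_carpet) U" "(0, 0) \<in> U" "U \<subseteq> {x. snd x < 1}"
  shows "ereal cantor_dim \<le> dim_H (top_of_set sierpinski_carpet frontier_of U)"
proof -
  obtain V where V: "open V" "U = sierpinski_carpet \<inter> V"
    using U(1) by (auto simp: openin_open)
  then obtain e where e: "e > 0" "ball (0, 0) e \<subseteq> V"
    using U(2) open_contains_ball by blast
  \<comment> \<open>By \<open>cantor_point_small\<close>, parameters below \<open>1 / 2 ^ k\<close>
    yield base points within distance \<open>e\<close> of the origin.\<close>
  obtain k where k: "(1 / 3) ^ k < e"
    using real_arch_pow_inv[of e "1 / 3"] e(1) by auto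
  have "\<exists>y. (cantor_point t, y) \<in> top_of_set sierpinski_carpet frontier_of U"
    if t: "t \<in> {0..<1 / 2 ^ k}" for t
  proof -
    have t1: "t \<in> {0..<1}"
      using t dyadic_interval_subset by blast
    let ?S = "{cantor_point t} \<times> {0..1::real}"
    have "connected ?S"
      by (intro convex_connected convex_Times) auto
    then have "connectedin (top_of_set sierpinski_carpet) ?S"
      using cantor_segment_in_carpet[OF t1] by (auto simp: connectedin_subtopology)
    moreover have "(cantor_point t, 0) \<in> ?S \<inter> U"
    proof -
      have "dist (0, 0) (cantor_point t, 0 :: real) < e"
        using cantor_point_small[OF t] cantor_point_bounds[of t] k
        by (simp add: dist_Pair_Pair power_one_over)
      then show ?thesis
        using cantor_segment_in_carpet[OF t1, of 0] e(2) V(2) by auto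
    qed
    moreover have "(cantor_point t, 1) \<in> ?S - U"
      using U(3) by auto
    ultimately have "?S \<inter> top_of_set sierpinski_carpet frontier_of U \<noteq> {}"
      by (intro connectedin_Int_frontier_of) blast+
    then show ?thesis by blast
  qed
  then show ?thesis by (rule dim_H_ge_cantor_dim)
qed

section \<open>Upper bound for the dimension of coverable sets\<close>

lemma hausdorff_premeasure_le_cover:
  fixes L :: "(real \<times> real) set"
  assumes A: "finite A" "L \<subseteq> (\<Union>p\<in>A. cball p \<rho>)" and "0 \<le> \<rho>" "2 * \<rho> \<le> \<delta>" "r > 0"
  shows "hausdorff_premeasure r \<delta> L \<le> ennreal (card A * (2 * \<rho>) powr r)"
proof -
  obtain h where h: "bij_betw h {0..<card A} A"
    using ex_bij_betw_nat_finite[OF A(1)] by blast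
  \<comment> \<open>The finite cover is padded to a sequence with empty sets, which contribute 0 to
    the sum.\<close>
  define U where "U i = (if i < card A then cball (h i) \<rho> else {})" for i
  have "L \<subseteq> (\<Union>i. U i)"
  proof
    fix x assume "x \<in> L"
    then obtain p where p: "p \<in> A" "x \<in> cball p \<rho>" using A(2) by blast
    then obtain i where "i < card A" "p = h i"
      using h by (metis atLeastLessThan_iff bij_betw_iff_bijections)
    then show "x \<in> (\<Union>i. U i)" using p(2) by (auto simp: U_def)
  qed
  moreover have "bounded (U i) \<and> diameter (U i) \<le> \<delta>" for i
    using assms by (simp add: U_def)
  ultimately have "hausdorff_premeasure r \<delta> L \<le> (\<Sum>i. diam_pow r (U i))"
    unfolding hausdorff_premeasure_def by (intro INF_lower) simp
  also have "\<dots> = (\<Sum>i<card A. diam_pow r (U i))"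
    by (intro suminf_finite) (auto simp: U_def diam_pow_def)
  also have "\<dots> = (\<Sum>i<card A. ennreal ((2 * \<rho>) powr r))"
    using assms by (intro sum.cong) (auto simp: U_def diam_pow_def)
  also have "\<dots> = ennreal (card A * (2 * \<rho>) powr r)"
    by (simp add: ennreal_mult ennreal_of_nat_eq_real_of_nat)
  finally show ?thesis .
qed

text \<open>The level \<open>m\<close> cover has total at most a constant times
  \<open>(2 / 3 powr r) ^ m\<close>, which tends to 0 because \<open>3 powr r\<close> exceeds
  2.\<close>

lemma hausdorff_measure_cantor_coverable:
  assumes L: "cantor_coverable L" and r: "cantor_dim < r"
  shows "hausdorff_measure r L = 0"
proof -
  obtain C A where A: "\<And>m::nat. finite (A m) \<and> card (A m) \<le> C * 2 ^ m \<and>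
     L \<subseteq> (\<Union>p\<in>A m. cball p (2 / 3 ^ m))"
    using L unfolding cantor_coverable_def by metis
  have r0: "0 < r" using r cantor_dim_pos by linarith
  have q: "2 < 3 powr r"
    using powr_less_mono[OF r, of 3] powr_cantor_dim_3 by simp
  \<comment> \<open>The 4 is the diameter of a ball of radius 2.\<close>
  define b where "b m = C * 4 powr r * (2 / 3 powr r) ^ m" for m
  have b: "b \<longlonglongrightarrow> 0"
    unfolding b_def using q by (intro tendsto_mult_right_zero LIMSEQ_realpow_zero) auto
  have bound: "hausdorff_premeasure r \<delta> L \<le> ennreal (b m)" if "4 / 3 ^ m \<le> \<delta>" for m \<delta>
  proof -
    have "hausdorff_premeasure r \<delta> L \<le> ennreal (card (A m) * (2 * (2 / 3 ^ m)) powr r)"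
      using A[of m] that r0 by (intro hausdorff_premeasure_le_cover) auto
    also have "\<dots> \<le> ennreal (real (C * 2 ^ m) * (2 * (2 / 3 ^ m)) powr r)"
      using A[of m] by (intro ennreal_leI mult_right_mono of_nat_mono) auto
    also have "(2 * (2 / 3 ^ m)) powr r = 4 powr r / (3 powr r) ^ m"
      by (simp add: powr_divide powr_power powr_powr mult.commute flip: powr_realpow)
    also have "real (C * 2 ^ m) * \<dots> = b m"
      by (simp add: b_def power_divide)
    finally show ?thesis .
  qed
  have "hausdorff_premeasure r \<delta> L \<le> 0" if "\<delta> > 0" for \<delta>
  proof -
    have "(\<lambda>m. 4 * (1 / 3) ^ m) \<longlonglongrightarrow> (0::real)"
      by (intro tendsto_mult_right_zero LIMSEQ_realpow_zero) auto
    then have "eventually (\<lambda>m. 4 * (1 / 3) ^ m < \<delta>) sequentially"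
      using that by (rule order_tendstoD(2))
    then have ev: "eventually (\<lambda>m. hausdorff_premeasure r \<delta> L \<le> ennreal (b m)) sequentially"
      by eventually_elim (auto intro!: bound simp: power_one_over)
    have "(\<lambda>m. ennreal (b m)) \<longlonglongrightarrow> ennreal 0"
      using b by (rule tendsto_ennrealI)
    then have "hausdorff_premeasure r \<delta> L \<le> ennreal 0"
      by (rule tendsto_lowerbound[OF _ ev]) simp
    then show ?thesis by simp
  qed
  then have "hausdorff_measure r L \<le> 0"
    unfolding hausdorff_measure_def by (intro SUP_least) auto
  then show ?thesis by simp
qed

lemma dim_H_cantor_coverable:
  assumes "cantor_coverable L"
  shows "dim_H L \<le> ereal cantor_dim"
proof (cases "L = {}")
  case True
  have "ereal (-1) \<le> ereal cantor_dim"
    using cantor_dim_pos by (intro ereal_less_eq(3)[THEN iffD2]) linarith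
  moreover have "dim_H L = ereal (-1)"
    using True by (simp add: dim_H_def one_ereal_def)
  ultimately show ?thesis by (simp only:)
next
  case False
  show ?thesis
  proof (rule ereal_le_epsilon2)
    fix e :: real assume e: "e > 0"
    have "hausdorff_measure (cantor_dim + e) L = 0"
      using e by (intro hausdorff_measure_cantor_coverable assms) simp
    moreover have "0 \<le> cantor_dim + e"
      using e cantor_dim_pos by linarith
    ultimately have "Inf {ereal s |s. 0 \<le> s \<and> hausdorff_measure s L = 0} \<le> ereal (cantor_dim + e)"
      by (intro Inf_lower) blast
    then show "dim_H L \<le> ereal cantor_dim + ereal e"
      using False by (simp add: dim_H_def)
  qed
qed

section \<open>A basis of boxes with small frontiers\<close>

definition carpet_basis :: "(real \<times> real) set set" where
  "carpet_basis = {sierpinski_carpet \<inter> box (a, b) (a', b') | a b a' b'.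
     {a, b, a', b'} \<subseteq> triadic_midpoints}"

lemma box_Pair: "box (a, b) (a', b') = {a<..<a'} \<times> {b<..<b' :: real}" for a :: real
  by (auto simp: mem_box Basis_prod_def)

text \<open>The frontier lies on the four sections through the sides of the box, all at triadic
  midpoints.\<close>

lemma dim_H_frontier_carpet_basis:
  assumes "U \<in> carpet_basis"
  shows "dim_H (top_of_set sierpinski_carpet frontier_of U) \<le> ereal cantor_dim"
proof -
  obtain a b a' b' where U: "U = sierpinski_carpet \<inter> box (a, b) (a', b')"
    and mid: "{a, b, a', b'} \<subseteq> triadic_midpoints"
    using assms unfolding carpet_basis_def by blast
  let ?L = "(carpet_line fst a \<union> carpet_line fst a') \<union> (carpet_line snd b \<union> carpet_line snd b')"
  have "cantor_coverable ?L"
    using mid by (intro cantor_coverable_Un cantor_coverable_line) auto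
  moreover have "sierpinski_carpet \<inter> (cbox (a, b) (a', b') - box (a, b) (a', b')) \<subseteq> ?L"
    by (auto simp: carpet_line_def box_Pair cbox_Pair_eq)
  ultimately have "cantor_coverable (top_of_set sierpinski_carpet frontier_of U)"
    unfolding U using box_frontier_subset by (meson cantor_coverable_subset order_trans)
  then show ?thesis by (rule dim_H_cantor_coverable)
qed

lemma basis_carpet_basis: "basis_of_topology (top_of_set sierpinski_carpet) carpet_basis"
  unfolding basis_of_topology_def
proof (intro conjI ballI allI impI)
  fix U assume "U \<in> carpet_basis"
  then show "openin (top_of_set sierpinski_carpet) U"
    unfolding carpet_basis_def by (auto intro!: openin_open_Int open_box)
next
  fix V assume "openin (top_of_set sierpinski_carpet) V"
  then obtain G where G: "open G" "V = sierpinski_carpet \<inter> G"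
    by (auto simp: openin_open)
  have "\<exists>U\<in>carpet_basis. (x, y) \<in> U \<and> U \<subseteq> V" if xy: "(x, y) \<in> V" for x y
  proof -
    obtain e where e: "e > 0" "ball (x, y) e \<subseteq> G"
      using xy G open_contains_ball by blast
    \<comment> \<open>Windows of width \<open>e / 2\<close> keep the sum of the coordinate
      differences, and thus the Euclidean distance, below \<open>e\<close>.\<close>
    have lt: "z - e / 2 < z" "z < z + e / 2" for z
      using e(1) by auto
    obtain a where a: "a \<in> triadic_midpoints" "x - e / 2 < a" "a < x"
      using triadic_midpoint_between[OF lt(1)] .
    obtain a' where a': "a' \<in> triadic_midpoints" "x < a'" "a' < x + e / 2"
      using triadic_midpoint_between[OF lt(2)] .
    obtain b where b: "b \<in> triadic_midpoints" "y - e / 2 < b" "b < y"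
      using triadic_midpoint_between[OF lt(1)] .
    obtain b' where b': "b' \<in> triadic_midpoints" "y < b'" "b' < y + e / 2"
      using triadic_midpoint_between[OF lt(2)] .
    have "box (a, b) (a', b') \<subseteq> ball (x, y) e"
    proof
      fix z assume "z \<in> box (a, b) (a', b')"
      then have "\<bar>x - fst z\<bar> < e / 2" "\<bar>y - snd z\<bar> < e / 2"
        using a a' b b' by (auto simp: box_Pair abs_if)
      then have "\<bar>x - fst z\<bar> + \<bar>y - snd z\<bar> < e" by linarith
      then show "z \<in> ball (x, y) e"
        using sqrt_sum_squares_le_sum_abs[of "x - fst z" "y - snd z"]
        by (cases z) (simp add: dist_Pair_Pair dist_real_def)
    qed
    then have "sierpinski_carpet \<inter> box (a, b) (a', b') \<subseteq> V"
      using e(2) G(2) by blast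
    moreover have "(x, y) \<in> sierpinski_carpet \<inter> box (a, b) (a', b')"
      using xy G(2) a a' b b' by (auto simp: box_Pair)
    moreover have "sierpinski_carpet \<inter> box (a, b) (a', b') \<in> carpet_basis"
      unfolding carpet_basis_def using a(1) a'(1) b(1) b'(1) by blast
    ultimately show ?thesis by blast
  qed
  then have "\<Union>{U \<in> carpet_basis. U \<subseteq> V} = V"
    by fastforce
  then show "\<exists>B'\<subseteq>carpet_basis. \<Union>B' = V"
    by (intro exI[of _ "{U \<in> carpet_basis. U \<subseteq> V}"]) auto
qed

theorem theorem5p4:
  shows "dim_tH sierpinski_carpet = ereal (ln 2 / ln 3 + 1) \<and>
    ereal (ln 2 / ln 3 + 1) = ereal (ln 6 / ln 3)"
proof
  define T where "T = top_of_set sierpinski_carpet"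
  define \<D> where "\<D> = {d :: ereal. \<exists>B. basis_of_topology T B \<and>
    (\<forall>U\<in>B. dim_H (T frontier_of U) \<le> d - 1)}"
  have "ereal (cantor_dim + 1) \<in> \<D>"
    unfolding \<D>_def T_def using basis_carpet_basis dim_H_frontier_carpet_basis
    by (auto simp: one_ereal_def)
  then have "Inf \<D> \<le> ereal (cantor_dim + 1)"
    by (rule Inf_lower)
  moreover have "ereal (cantor_dim + 1) \<le> d" if d: "d \<in> \<D>" for d
  proof -
    obtain B where B: "basis_of_topology T B" "\<forall>U\<in>B. dim_H (T frontier_of U) \<le> d - 1"
      using d unfolding \<D>_def by blast
    \<comment> \<open>This open set contains the origin but no point of the top side. Any basis must
      contain a set between the two, to which \<open>dim_H_frontier_ge\<close> applies.\<close>
    let ?V = "sierpinski_carpet \<inter> {x. snd x < 1}"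
    have "openin T ?V"
      unfolding T_def by (intro openin_open_Int open_Collect_less continuous_intros)
    then obtain B' where B': "B' \<subseteq> B" "\<Union>B' = ?V"
      using B(1) unfolding basis_of_topology_def by blast
    have "(0, 0) \<in> ?V"
      using cantor_segment_in_carpet[of 0 0] by (simp add: cantor_point_0)
    then obtain U where U: "U \<in> B" "(0, 0) \<in> U" "U \<subseteq> ?V"
      using B' by blast
    have "openin T U"
      using B(1) U(1) unfolding basis_of_topology_def by blast
    then have "ereal cantor_dim \<le> dim_H (T frontier_of U)"
      using U unfolding T_def by (intro dim_H_frontier_ge) auto
    also have "\<dots> \<le> d - 1"
      using B(2) U(1) by blast
    finally show ?thesis
      \<comment> \<open>For \<open>d\<close> equal to \<infinity> the claim is trivial, and
        -\<infinity> contradicts the chain just derived.\<close>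
      by (cases d) (auto simp: one_ereal_def)
  qed
  then have "ereal (cantor_dim + 1) \<le> Inf \<D>"
    by (rule Inf_greatest)
  ultimately show "dim_tH sierpinski_carpet = ereal (ln 2 / ln 3 + 1)"
    using sierpinski_carpet_attractor[THEN conjunct1]
    by (simp add: dim_tH_def \<D>_def T_def)
  have "ln (6::real) = ln 2 + ln 3"
    using ln_mult[of 2 "3::real"] by simp
  then show "ereal (ln 2 / ln 3 + 1) = ereal (ln 6 / ln 3)"
    by (simp add: field_simps)
qed

end
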